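(* Let $N\ge2$, $m\ge 1$, let $y^{(1)},\dots,y^{(m)}\in\mathbb R^{N-1}$ be unit vectors, let $\delta\in\mathbb R$, and let $(\bar x,\bar s)\in\mathbb R^{N-1}\times\mathbb R_+$ with $\|\bar x\|_2>\bar s$. Consider the problem $$\max_{y\in\mathbb R^{N-1}}\ y^\top\bar x-\bar s\quad\text{s.t.}\quad \|y\|_2=1,\quad y^\top y^{(i)}\le\delta,\ i=1,\dots,m. \qquad (\ast)$$ Let $S\subseteq\{1,\dots,m\}$. Suppose $S$ is the active set, with respect to the constraints $y^\top y^{(i)}\le\delta$, of some optimal solution of $(\ast)$, and that the vectors $\{y^{(i)}:i\in S\}$ are linearly independent. Let $A_S=[y^{(i)}]_{i\in S}$ be the matrix with columns $y^{(i)}$, $i\in S$, let $\delta_S=(\delta,\dots,\delta)\in\mathbb R^{|S|}$, and let $$p_S=A_S(A_S^\top A_S)^{-1}\delta_S,\qquad P_S=I-A_S(A_S^\top A_S)^{-1}A_S^\top .$$ If $P_S\bar x\ne0$, then the point $$y^*=p_S+\sqrt{1-\|p_S\|_2^2}\,\frac{P_S\bar x}{\|P_S\bar x\|_2}$$ is optimal for $(\ast)$ provided it satisfies $(y^* )^\top y^{(i)}\le\delta$ for all $i=1,\dots,m$. If $P_S\bar x=0$, then every point $y=p_S+z$ with $z\in\mathrm{Null}(A_S^\top)$ and $\|y\|_2=1$ that is feasible for $(\ast)$ is optimal for $(\ast)$.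
   Context: The active set of a feasible point $y$ of $(\ast)$ is $\{i\in\{1,\dots,m\}: y^\top y^{(i)}=\delta\}$. If $S=\emptyset$, use the conventions $p_S=0$, $P_S=I$, $\mathrm{Null}(A_S^\top)=\mathbb R^{N-1}$. *)

theory Defs
  imports
    Complex_Main
    "Jordan_Normal_Form.Matrix_Kernel"
    "Jordan_Normal_Form.Gauss_Jordan_Elimination"
    "Jordan_Normal_Form.VS_Connect"
begin

text \<open>The space \<open>\<real>\<^sup>n\<close> is \<open>carrier_vec n :: real vec set\<close>. The dimension-indexed matrices
  of \<open>Jordan_Normal_Form\<close> are used because the number of columns of \<open>A\<^sub>S\<close> is the
  cardinality of a set of indices, and may be \<open>0\<close>.\<close>

definition enorm :: "real vec \<Rightarrow> real" where
  "enorm v = sqrt (v \<bullet> v)"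

definition feasible_set :: "nat \<Rightarrow> nat \<Rightarrow> (nat \<Rightarrow> real vec) \<Rightarrow> real \<Rightarrow> real vec set" where
  "feasible_set n m Y \<delta> =
     {y \<in> carrier_vec n. enorm y = 1 \<and> (\<forall>i\<in>{1..m}. y \<bullet> Y i \<le> \<delta>)}"

definition objective :: "real vec \<Rightarrow> real \<Rightarrow> real vec \<Rightarrow> real" where
  "objective xbar sbar y = y \<bullet> xbar - sbar"

definition optimal ::
  "nat \<Rightarrow> nat \<Rightarrow> (nat \<Rightarrow> real vec) \<Rightarrow> real \<Rightarrow> real vec \<Rightarrow> real \<Rightarrow> real vec \<Rightarrow> bool" where
  "optimal n m Y \<delta> xbar sbar y \<longleftrightarrow>
     y \<in> feasible_set n m Y \<delta> \<and>
     (\<forall>w\<in>feasible_set n m Y \<delta>. objective xbar sbar w \<le> objective xbar sbar y)"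

definition active_set :: "nat \<Rightarrow> (nat \<Rightarrow> real vec) \<Rightarrow> real \<Rightarrow> real vec \<Rightarrow> nat set" where
  "active_set m Y \<delta> y = {i \<in> {1..m}. y \<bullet> Y i = \<delta>}"

text \<open>Linear independence of the indexed family \<open>(Y i)\<^sub>i\<^sub>\<in>\<^sub>S\<close>: the library notion concerns sets
  of vectors, so repetitions in the family are excluded separately.\<close>

definition lin_indpt_family :: "nat \<Rightarrow> (nat \<Rightarrow> real vec) \<Rightarrow> nat set \<Rightarrow> bool" where
  "lin_indpt_family n Y S \<longleftrightarrow>
     inj_on Y S \<and>
     LinearCombinations.module.lin_indpt class_ring (module_vec TYPE(real) n) (Y ` S)"

text \<open>The columns are the \<open>Y i\<close> with \<open>i \<in> S\<close>, in increasing order of \<open>i\<close> (\<open>S\<close> finite).\<close>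

definition A_mat :: "nat \<Rightarrow> (nat \<Rightarrow> real vec) \<Rightarrow> nat set \<Rightarrow> real mat" where
  "A_mat n Y S = mat_of_cols n (map Y (sorted_list_of_set S))"

text \<open>\<open>mat_inverse\<close> returns \<open>None\<close> exactly on non-invertible arguments, for which \<open>mat_inv\<close> is
  unspecified.\<close>

definition mat_inv :: "real mat \<Rightarrow> real mat" where
  "mat_inv B = the (mat_inverse B)"

definition p_vec :: "nat \<Rightarrow> (nat \<Rightarrow> real vec) \<Rightarrow> real \<Rightarrow> nat set \<Rightarrow> real vec" where
  "p_vec n Y \<delta> S = (let A = A_mat n Y S in
     (A * mat_inv (A\<^sup>T * A)) *\<^sub>v vec (card S) (\<lambda>_. \<delta>))"

definition P_mat :: "nat \<Rightarrow> (nat \<Rightarrow> real vec) \<Rightarrow> nat set \<Rightarrow> real mat" where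
  "P_mat n Y S = (let A = A_mat n Y S in 1\<^sub>m n - A * mat_inv (A\<^sup>T * A) * A\<^sup>T)"

text \<open>For \<open>S = {}\<close> the usual conventions hold with these definitions, since \<open>A\<^sub>S\<close> is then
  an \<open>n \<times> 0\<close> matrix.\<close>

lemma mat_inv_0: "B \<in> carrier_mat 0 0 \<Longrightarrow> mat_inv B \<in> carrier_mat 0 0"
proof -
  assume B: "B \<in> carrier_mat 0 0"
  have "B * B = 1\<^sub>m 0" using B by (intro eq_matI) auto
  then have "B \<in> Units (ring_mat TYPE(real) 0 ())"
    using B by (auto simp: Units_def ring_mat_def)
  then obtain C where "mat_inverse B = Some C"
    using mat_inverse(1)[OF B, of "()"] by (cases "mat_inverse B") auto
  then show ?thesis using mat_inverse(2)[OF B] by (simp add: mat_inv_def)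
qed

lemma A_mat_empty: "A_mat n Y {} \<in> carrier_mat n 0"
  by (simp add: A_mat_def mat_of_cols_def)

lemma p_vec_empty: "p_vec n Y \<delta> {} = 0\<^sub>v n"
proof -
  let ?A = "A_mat n Y {}"
  have A: "?A \<in> carrier_mat n 0" by (rule A_mat_empty)
  have I: "mat_inv (?A\<^sup>T * ?A) \<in> carrier_mat 0 0" by (rule mat_inv_0) (use A in auto)
  show ?thesis using A I unfolding p_vec_def Let_def
    by (intro eq_vecI) (auto simp: scalar_prod_def)
qed

lemma P_mat_empty: "P_mat n Y {} = 1\<^sub>m n"
proof -
  let ?A = "A_mat n Y {}"
  have A: "?A \<in> carrier_mat n 0" by (rule A_mat_empty)
  have I: "mat_inv (?A\<^sup>T * ?A) \<in> carrier_mat 0 0" by (rule mat_inv_0) (use A in auto)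
  show ?thesis using A I unfolding P_mat_def Let_def
    by (intro eq_matI) (auto simp: scalar_prod_def)
qed

lemma kernel_empty: "mat_kernel ((A_mat n Y {})\<^sup>T) = carrier_vec n"
  using A_mat_empty[of n Y] by (auto simp: mat_kernel_def intro!: eq_vecI)

end

theory Submission
  imports Defs "Jordan_Normal_Form.DL_Rank"
begin

text \<open>The optimal solution whose active set is \<open>S\<close> serves as a benchmark. Call
  it \<open>y\<close>. Activity of the constraints in \<open>S\<close> says that
  \<open>A\<^sup>T y = \<delta>\<^sub>S\<close>, so \<open>y\<close> lies on the slice of the unit sphere cut out by this linear system. The
  columns of \<open>A\<close> being independent, the Gram matrix \<open>A\<^sup>T A\<close> is invertible
  (\<open>gram_inverse\<close>), so \<open>p\<close> solves the system and is orthogonal to the kernel of \<open>A\<^sup>T\<close>. Hence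
  \<open>y = p + z\<close> with \<open>z\<close> in this kernel, and by Pythagoras \<open>\<parallel>z\<parallel>\<^sup>2 = 1 - \<parallel>p\<parallel>\<^sup>2\<close>
  (\<open>slice_decomposition\<close>).

  The matrix \<open>P\<close> is the orthogonal projection onto the same kernel, whence \<open>z \<bullet> xbar = z \<bullet> P xbar\<close>
  (\<open>kernel_scalar_prod_proj\<close>): up to the constant \<open>p \<bullet> xbar\<close>, the objective on the slice is the
  linear functional \<open>P xbar\<close> on a sphere of radius \<open>sqrt (1 - \<parallel>p\<parallel>\<^sup>2)\<close> around the origin of the
  kernel. If \<open>P xbar\<close> is nonzero, Cauchy--Schwarz shows that the functional is maximal in the
  direction of \<open>P xbar\<close>, which is the point \<open>ystar\<close> (\<open>slice_maximizer\<close>); if it vanishes, the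
  objective is constant on the slice (\<open>slice_constant\<close>). In both cases the point in question does
  at least as well as \<open>y\<close>, whose value is already the optimum, so feasibility is all that is
  needed for it to be optimal.\<close>

section \<open>The Euclidean norm on real vectors\<close>

lemma scalar_prod_self_nonneg: "(v :: real vec) \<bullet> v \<ge> 0"
  by (simp add: scalar_prod_def sum_nonneg)

lemma enorm_nonneg: "enorm v \<ge> 0"
  by (simp add: enorm_def scalar_prod_self_nonneg)

lemma enorm_power2: "(enorm v)\<^sup>2 = v \<bullet> v"
  by (simp add: enorm_def scalar_prod_self_nonneg)

lemma enorm_eq_1_iff: "enorm v = 1 \<longleftrightarrow> v \<bullet> v = 1"
  by (simp add: enorm_def)

lemma scalar_prod_self_eq_0_iff:
  assumes "(v :: real vec) \<in> carrier_vec n"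
  shows "v \<bullet> v = 0 \<longleftrightarrow> v = 0\<^sub>v n"
  using conjugate_square_eq_0_vec[OF assms] by (simp add: conjugate_id)

lemma enorm_smult: "enorm (c \<cdot>\<^sub>v v) = \<bar>c\<bar> * enorm v"
proof -
  have "(c \<cdot>\<^sub>v v) \<bullet> (c \<cdot>\<^sub>v v) = c\<^sup>2 * (v \<bullet> v)"
    by (simp add: power2_eq_square)
  then show ?thesis by (simp add: enorm_def real_sqrt_mult)
qed

lemma scalar_prod_le_enorm_mult:
  assumes v: "v \<in> carrier_vec n" and w: "w \<in> carrier_vec n"
  shows "v \<bullet> w \<le> enorm v * enorm w"
proof (cases "enorm v = 0 \<or> enorm w = 0")
  case True
  then have "v = 0\<^sub>v n \<or> w = 0\<^sub>v n"
    using scalar_prod_self_eq_0_iff v w by (auto simp: enorm_def)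
  then show ?thesis using v w by (auto simp: enorm_nonneg)
next
  case False
  \<comment> \<open>Expand the square of the vector that vanishes in the equality case,
    where \<open>v\<close> and \<open>w\<close> have the same direction.\<close>
  let ?a = "enorm v" and ?b = "enorm w"
  let ?d = "?b \<cdot>\<^sub>v v - ?a \<cdot>\<^sub>v w"
  have bv: "?b \<cdot>\<^sub>v v \<in> carrier_vec n" and aw: "?a \<cdot>\<^sub>v w \<in> carrier_vec n"
    using v w by simp_all
  have d: "?d \<in> carrier_vec n" using bv aw by simp
  have "?d \<bullet> ?d = ?b * (?b * (v \<bullet> v) - ?a * (v \<bullet> w)) - ?a * (?b * (w \<bullet> v) - ?a * (w \<bullet> w))"
    using v w by (simp add: minus_scalar_prod_distrib[OF bv aw d]
        scalar_prod_minus_distrib[OF v bv aw] scalar_prod_minus_distrib[OF w bv aw])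
  also have "\<dots> = 2 * (?a * ?b) * (?a * ?b - v \<bullet> w)"
    by (simp add: comm_scalar_prod[OF w v] flip: enorm_power2)
       (simp add: algebra_simps power2_eq_square)
  finally have "0 \<le> (?a * ?b) * (?a * ?b - v \<bullet> w)"
    using scalar_prod_self_nonneg[of ?d] by simp
  moreover have "?a * ?b > 0"
    using False enorm_nonneg[of v] enorm_nonneg[of w] by (simp add: less_le)
  ultimately show ?thesis by (simp add: zero_le_mult_iff)
qed

lemma orthogonal_add_power2:
  assumes v: "(v :: real vec) \<in> carrier_vec n" and w: "w \<in> carrier_vec n" and "v \<bullet> w = 0"
  shows "(v + w) \<bullet> (v + w) = v \<bullet> v + w \<bullet> w"
proof -
  have "w \<bullet> v = 0" using comm_scalar_prod[OF w v] assms(3) by simp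
  moreover have "v + w \<in> carrier_vec n" using v w by simp
  ultimately show ?thesis
    using assms by (simp add: add_scalar_prod_distrib[OF v w] scalar_prod_add_distrib[OF v v w]
        scalar_prod_add_distrib[OF w v w])
qed

section \<open>Linear systems of full rank and their slices of the unit sphere\<close>

text \<open>Trivial kernel is the form in which independence of the columns is used. It also covers
  \<open>k = 0\<close>, where the kernel of \<open>A\<^sup>T\<close> is the whole space.\<close>

locale full_column_rank =
  fixes A :: "real mat" and n k :: nat
  assumes A [simp]: "A \<in> carrier_mat n k"
    and inj: "\<And>v. v \<in> carrier_vec k \<Longrightarrow> A *\<^sub>v v = 0\<^sub>v n \<Longrightarrow> v = 0\<^sub>v k"
begin

abbreviation gram_inv :: "real mat" where "gram_inv \<equiv> mat_inv (A\<^sup>T * A)"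

abbreviation proj_kernel :: "real mat" where "proj_kernel \<equiv> 1\<^sub>m n - A * gram_inv * A\<^sup>T"

lemma At [simp]: "A\<^sup>T \<in> carrier_mat k n" by simp

text \<open>If \<open>A\<^sup>T A v = 0\<close>, then \<open>\<parallel>A v\<parallel>\<^sup>2 = v \<bullet> A\<^sup>T A v = 0\<close>, so \<open>v\<close> is in the trivial kernel of \<open>A\<close>.\<close>

lemma gram_inverse: "gram_inv \<in> carrier_mat k k" "(A\<^sup>T * A) * gram_inv = 1\<^sub>m k"
proof -
  have G: "A\<^sup>T * A \<in> carrier_mat k k" by (rule mult_carrier_mat[OF At A])
  have "det (A\<^sup>T * A) \<noteq> 0"
  proof
    assume "det (A\<^sup>T * A) = 0"
    then obtain v where v: "v \<in> carrier_vec k" "v \<noteq> 0\<^sub>v k" "(A\<^sup>T * A) *\<^sub>v v = 0\<^sub>v k"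
      using det_0_iff_vec_prod_zero[OF G] by auto
    have Av: "A *\<^sub>v v \<in> carrier_vec n" using A v(1) by (rule mult_mat_vec_carrier)
    have "(A *\<^sub>v v) \<bullet> (A *\<^sub>v v) = (A\<^sup>T *\<^sub>v (A *\<^sub>v v)) \<bullet> v"
      using transpose_vec_mult_scalar[OF A v(1) Av] by simp
    also have "\<dots> = 0"
      using v assoc_mult_mat_vec[OF At A v(1)] by simp
    finally show False
      using scalar_prod_self_eq_0_iff[OF Av] inj v by blast
  qed
  then obtain H where H: "mat_inverse (A\<^sup>T * A) = Some H"
    using mat_inverse(1)[OF G, of "()"] det_non_zero_imp_unit[OF G, of "()"]
    by (cases "mat_inverse (A\<^sup>T * A)") auto
  then show "gram_inv \<in> carrier_mat k k" "(A\<^sup>T * A) * gram_inv = 1\<^sub>m k"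
    using mat_inverse(2)[OF G H] by (simp_all add: mat_inv_def)
qed

lemma pinv_carrier: "A * gram_inv \<in> carrier_mat n k"
  by (rule mult_carrier_mat[OF A gram_inverse(1)])

lemma transpose_mult_pinv: "A\<^sup>T * (A * gram_inv) = 1\<^sub>m k"
  using assoc_mult_mat[OF At A gram_inverse(1)] gram_inverse(2) by simp

lemma transpose_mult_least_norm:
  assumes "d \<in> carrier_vec k"
  shows "A\<^sup>T *\<^sub>v ((A * gram_inv) *\<^sub>v d) = d"
  using assoc_mult_mat_vec[OF At pinv_carrier assms] transpose_mult_pinv assms by simp

text \<open>The vector \<open>A (A\<^sup>T A)\<inverse> d\<close> is in the range of \<open>A\<close>, which is orthogonal to the kernel of
  \<open>A\<^sup>T\<close>. Together with the preceding lemma this makes it the solution of \<open>A\<^sup>T y = d\<close> of least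
  norm.\<close>

lemma kernel_orthogonal:
  assumes d: "d \<in> carrier_vec k" and z: "z \<in> carrier_vec n" "A\<^sup>T *\<^sub>v z = 0\<^sub>v k"
  shows "z \<bullet> ((A * gram_inv) *\<^sub>v d) = 0"
proof -
  have Hd: "gram_inv *\<^sub>v d \<in> carrier_vec k"
    using gram_inverse(1) d by (rule mult_mat_vec_carrier)
  have "z \<bullet> ((A * gram_inv) *\<^sub>v d) = z \<bullet> (A *\<^sub>v (gram_inv *\<^sub>v d))"
    using assoc_mult_mat_vec[OF A gram_inverse(1) d] by simp
  also have "\<dots> = (A\<^sup>T *\<^sub>v z) \<bullet> (gram_inv *\<^sub>v d)"
    using transpose_vec_mult_scalar[OF A Hd z(1)] by simp
  finally show ?thesis using z Hd by simp
qed

lemma proj_kernel_apply: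
  assumes x: "x \<in> carrier_vec n"
  shows "proj_kernel *\<^sub>v x = x - (A * gram_inv) *\<^sub>v (A\<^sup>T *\<^sub>v x)"
  using assms minus_mult_distrib_mat_vec[OF one_carrier_mat mult_carrier_mat[OF pinv_carrier At] x]
    assoc_mult_mat_vec[OF pinv_carrier At x] by simp

lemma proj_kernel_in_kernel:
  assumes x: "x \<in> carrier_vec n"
  shows "proj_kernel *\<^sub>v x \<in> carrier_vec n" "A\<^sup>T *\<^sub>v (proj_kernel *\<^sub>v x) = 0\<^sub>v k"
proof -
  have Ax: "A\<^sup>T *\<^sub>v x \<in> carrier_vec k" using At x by (rule mult_mat_vec_carrier)
  have q: "(A * gram_inv) *\<^sub>v (A\<^sup>T *\<^sub>v x) \<in> carrier_vec n"
    using pinv_carrier Ax by (rule mult_mat_vec_carrier)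
  show "proj_kernel *\<^sub>v x \<in> carrier_vec n"
    using x q by (simp add: proj_kernel_apply[OF x])
  show "A\<^sup>T *\<^sub>v (proj_kernel *\<^sub>v x) = 0\<^sub>v k"
    using Ax by (simp add: proj_kernel_apply[OF x] mult_minus_distrib_mat_vec[OF At x q]
        transpose_mult_least_norm)
qed

text \<open>The difference \<open>x - P x = A (A\<^sup>T A)\<inverse> (A\<^sup>T x)\<close> is a least-norm solution as in
  \<open>kernel_orthogonal\<close>, hence orthogonal to the kernel.\<close>

lemma kernel_scalar_prod_proj:
  assumes x: "x \<in> carrier_vec n" and z: "z \<in> carrier_vec n" "A\<^sup>T *\<^sub>v z = 0\<^sub>v k"
  shows "z \<bullet> (proj_kernel *\<^sub>v x) = z \<bullet> x"
proof -
  have Ax: "A\<^sup>T *\<^sub>v x \<in> carrier_vec k" using At x by (rule mult_mat_vec_carrier)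
  have q: "(A * gram_inv) *\<^sub>v (A\<^sup>T *\<^sub>v x) \<in> carrier_vec n"
    using pinv_carrier Ax by (rule mult_mat_vec_carrier)
  show ?thesis
    using kernel_orthogonal[OF Ax z]
    by (simp add: proj_kernel_apply[OF x] scalar_prod_minus_distrib[OF z(1) x q])
qed

text \<open>The Pythagorean identity is part of the conclusion because it fixes the norm of \<open>z\<close> on the unit
  sphere, and shows in passing that \<open>1 - \<parallel>p\<parallel>\<^sup>2\<close> is nonnegative.\<close>

lemma slice_decomposition:
  assumes d: "d \<in> carrier_vec k" and y: "y \<in> carrier_vec n" "A\<^sup>T *\<^sub>v y = d"
  defines "p \<equiv> (A * gram_inv) *\<^sub>v d"
  obtains z where "z \<in> carrier_vec n" "A\<^sup>T *\<^sub>v z = 0\<^sub>v k" "y = p + z"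
    "y \<bullet> y = p \<bullet> p + z \<bullet> z"
proof
  have p: "p \<in> carrier_vec n"
    unfolding p_def using pinv_carrier d by (rule mult_mat_vec_carrier)
  show z: "y - p \<in> carrier_vec n" using y p by simp
  show Az: "A\<^sup>T *\<^sub>v (y - p) = 0\<^sub>v k"
    using y d by (simp add: mult_minus_distrib_mat_vec[OF At y(1) p]
        transpose_mult_least_norm[OF d, folded p_def])
  show yp: "y = p + (y - p)" using y p by auto
  have "p \<bullet> (y - p) = 0"
    using kernel_orthogonal[OF d z Az] comm_scalar_prod[OF p z] by (simp add: p_def)
  from orthogonal_add_power2[OF p z this]
  show "y \<bullet> y = p \<bullet> p + (y - p) \<bullet> (y - p)" unfolding yp[symmetric] .
qed

text \<open>Cauchy--Schwarz within the kernel: \<open>z \<bullet> x = z \<bullet> u \<le> \<parallel>z\<parallel> \<parallel>u\<parallel>\<close>, with equality when \<open>z\<close> is the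
  multiple of \<open>u\<close> of the prescribed length. The existence of some \<open>y\<close> on the slice is what makes the
  square root meaningful, and therefore what puts \<open>ymax\<close> on the unit sphere.\<close>

lemma slice_maximizer:
  assumes d: "d \<in> carrier_vec k" and x: "x \<in> carrier_vec n"
    and y: "y \<in> carrier_vec n" "A\<^sup>T *\<^sub>v y = d" "enorm y = 1"
  defines "p \<equiv> (A * gram_inv) *\<^sub>v d" and "u \<equiv> proj_kernel *\<^sub>v x"
  defines "ymax \<equiv> p + sqrt (1 - (enorm p)\<^sup>2) \<cdot>\<^sub>v ((1 / enorm u) \<cdot>\<^sub>v u)"
  assumes u0: "u \<noteq> 0\<^sub>v n"
  shows "ymax \<in> carrier_vec n" "enorm ymax = 1" "y \<bullet> x \<le> ymax \<bullet> x"
proof -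
  obtain z where z: "z \<in> carrier_vec n" "A\<^sup>T *\<^sub>v z = 0\<^sub>v k" "y = p + z"
      "y \<bullet> y = p \<bullet> p + z \<bullet> z"
    using slice_decomposition[OF d y(1,2)] unfolding p_def by blast
  define r where "r = sqrt (1 - (enorm p)\<^sup>2)"
  have r2: "z \<bullet> z = 1 - (enorm p)\<^sup>2"
    using z(4) y(3) by (simp add: enorm_power2 enorm_eq_1_iff)
  then have rz: "r = enorm z" by (simp add: r_def enorm_def)
  have p: "p \<in> carrier_vec n"
    unfolding p_def using pinv_carrier d by (rule mult_mat_vec_carrier)
  have u: "u \<in> carrier_vec n" "A\<^sup>T *\<^sub>v u = 0\<^sub>v k"
    unfolding u_def using proj_kernel_in_kernel[OF x] by auto
  define w where "w = r \<cdot>\<^sub>v ((1 / enorm u) \<cdot>\<^sub>v u)"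
  have w: "w \<in> carrier_vec n" using u by (simp add: w_def)
  have ymax: "ymax = p + w" by (simp add: ymax_def w_def r_def)
  show "ymax \<in> carrier_vec n" using p w by (simp add: ymax)
  have eu: "enorm u > 0"
    using u0 scalar_prod_self_eq_0_iff[OF u(1)] scalar_prod_self_nonneg[of u]
    by (simp add: enorm_def)
  have "enorm w = r"
    using eu by (simp add: w_def enorm_smult rz enorm_nonneg)
  then have ww: "w \<bullet> w = z \<bullet> z"
    using rz by (metis enorm_power2)
  have "p \<bullet> u = 0"
    using kernel_orthogonal[OF d u] comm_scalar_prod[OF p u(1)] by (simp add: p_def)
  then have "p \<bullet> w = 0"
    using p u by (simp add: w_def)
  from orthogonal_add_power2[OF p w this]
  show "enorm ymax = 1"
    using ww r2 by (simp add: ymax enorm_eq_1_iff enorm_power2)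
  have ux: "u \<bullet> x = (enorm u)\<^sup>2"
    using kernel_scalar_prod_proj[OF x u] by (simp add: u_def enorm_power2)
  have "z \<bullet> x = z \<bullet> u"
    using kernel_scalar_prod_proj[OF x z(1,2)] by (simp add: u_def)
  also have "\<dots> \<le> r * enorm u"
    unfolding rz by (rule scalar_prod_le_enorm_mult[OF z(1) u(1)])
  also have "\<dots> = w \<bullet> x"
    using u x eu by (simp add: w_def ux power2_eq_square)
  finally show "y \<bullet> x \<le> ymax \<bullet> x"
    using z(3) by (simp add: ymax add_scalar_prod_distrib[OF p z(1) x]
        add_scalar_prod_distrib[OF p w x])
qed

lemma slice_constant:
  assumes x: "x \<in> carrier_vec n" "proj_kernel *\<^sub>v x = 0\<^sub>v n"
    and p: "p \<in> carrier_vec n" and z: "z \<in> carrier_vec n" "A\<^sup>T *\<^sub>v z = 0\<^sub>v k"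
  shows "(p + z) \<bullet> x = p \<bullet> x"
  using kernel_scalar_prod_proj[OF x(1) z] x z
  by (simp add: add_scalar_prod_distrib[OF p z(1) x(1)])

end

section \<open>The matrix of active constraints\<close>

lemma A_mat_carrier:
  assumes "finite S" shows "A_mat n Y S \<in> carrier_mat n (card S)"
  using assms by (simp add: A_mat_def mat_of_cols_def)

lemma transpose_A_mat_mult:
  assumes "finite S" "\<And>i. i \<in> S \<Longrightarrow> Y i \<in> carrier_vec n" "y \<in> carrier_vec n"
    and eq: "\<And>i. i \<in> S \<Longrightarrow> y \<bullet> Y i = c"
  shows "(A_mat n Y S)\<^sup>T *\<^sub>v y = vec (card S) (\<lambda>_. c)"
proof (rule eq_vecI)
  fix j assume "j < dim_vec (vec (card S) (\<lambda>_. c))"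
  then have j: "j < length (sorted_list_of_set S)" using assms by simp
  then have iS: "sorted_list_of_set S ! j \<in> S"
    using assms(1) nth_mem[OF j] by simp
  have "((A_mat n Y S)\<^sup>T *\<^sub>v y) $ j = Y (sorted_list_of_set S ! j) \<bullet> y"
    using j assms(2)[OF iS] by (simp add: A_mat_def)
  then show "((A_mat n Y S)\<^sup>T *\<^sub>v y) $ j = vec (card S) (\<lambda>_. c) $ j"
    using eq[OF iS] comm_scalar_prod[OF assms(2)[OF iS] assms(3)] j by simp
qed (use assms(1) in \<open>simp add: A_mat_def\<close>)

text \<open>Injectivity of \<open>Y\<close> on \<open>S\<close> makes the columns distinct, so that independence of the family
  becomes independence of the set of columns.\<close>

lemma full_column_rank_A_mat:
  assumes fin: "finite S" and Y: "\<And>i. i \<in> S \<Longrightarrow> Y i \<in> carrier_vec n"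
    and indpt: "lin_indpt_family n Y S"
  shows "full_column_rank (A_mat n Y S) n (card S)"
proof
  show A: "A_mat n Y S \<in> carrier_mat n (card S)" by (rule A_mat_carrier[OF fin])
  have cols: "cols (A_mat n Y S) = map Y (sorted_list_of_set S)"
    unfolding A_mat_def by (rule cols_mat_of_cols) (use fin Y in auto)
  fix v :: "real vec"
  assume v: "v \<in> carrier_vec (card S)" "A_mat n Y S *\<^sub>v v = 0\<^sub>v n"
  show "v = 0\<^sub>v (card S)"
  proof (rule ccontr)
    assume "v \<noteq> 0\<^sub>v (card S)"
    from vec_space.lin_depI[OF A v(1) this v(2)] show False
      using indpt fin by (auto simp: cols distinct_map lin_indpt_family_def)
  qed
qed

section \<open>Optimality of the closed-form point\<close>

theorem proposition2p7:
  fixes N m :: nat and Y :: "nat \<Rightarrow> real vec" and \<delta> sbar :: real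
    and xbar :: "real vec" and S :: "nat set"
  assumes N: "N \<ge> 2" and m: "m \<ge> 1"
    and Y_dim: "\<And>i. i \<in> {1..m} \<Longrightarrow> Y i \<in> carrier_vec (N - 1)"
    and Y_unit: "\<And>i. i \<in> {1..m} \<Longrightarrow> enorm (Y i) = 1"
    and xbar: "xbar \<in> carrier_vec (N - 1)" and sbar: "sbar \<ge> 0"
    and xbar_sbar: "enorm xbar > sbar"
    and S: "S \<subseteq> {1..m}"
    and S_active: "\<exists>y. optimal (N - 1) m Y \<delta> xbar sbar y \<and> active_set m Y \<delta> y = S"
    and S_indpt: "lin_indpt_family (N - 1) Y S"
  defines "A \<equiv> A_mat (N - 1) Y S"
    and "p \<equiv> p_vec (N - 1) Y \<delta> S"
    and "P \<equiv> P_mat (N - 1) Y S"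
  defines "ystar \<equiv> p + sqrt (1 - (enorm p)\<^sup>2) \<cdot>\<^sub>v ((1 / enorm (P *\<^sub>v xbar)) \<cdot>\<^sub>v (P *\<^sub>v xbar))"
  shows "(P *\<^sub>v xbar \<noteq> 0\<^sub>v (N - 1) \<longrightarrow> (\<forall>i\<in>{1..m}. ystar \<bullet> Y i \<le> \<delta>) \<longrightarrow>
            optimal (N - 1) m Y \<delta> xbar sbar ystar) \<and>
         (P *\<^sub>v xbar = 0\<^sub>v (N - 1) \<longrightarrow>
            (\<forall>z\<in>mat_kernel (A\<^sup>T). enorm (p + z) = 1 \<longrightarrow>
               p + z \<in> feasible_set (N - 1) m Y \<delta> \<longrightarrow>
               optimal (N - 1) m Y \<delta> xbar sbar (p + z)))"
proof -
  have fin: "finite S" using S finite_subset by blast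
  have YS: "\<And>i. i \<in> S \<Longrightarrow> Y i \<in> carrier_vec (N - 1)" using S Y_dim by blast
  interpret full_column_rank A "N - 1" "card S"
    unfolding A_def by (rule full_column_rank_A_mat[OF fin YS S_indpt])
  let ?d = "vec (card S) (\<lambda>_. \<delta>) :: real vec"
  have d: "?d \<in> carrier_vec (card S)" by simp
  have p_eq: "p = (A * gram_inv) *\<^sub>v ?d"
    by (simp add: p_def p_vec_def A_def Let_def)
  have P_eq: "P = proj_kernel"
    by (simp add: P_def P_mat_def A_def Let_def)
  have p: "p \<in> carrier_vec (N - 1)"
    unfolding p_eq using pinv_carrier d by (rule mult_mat_vec_carrier)
  obtain y where opt: "optimal (N - 1) m Y \<delta> xbar sbar y" and act: "active_set m Y \<delta> y = S"
    using S_active by blast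
  have y: "y \<in> carrier_vec (N - 1)" "enorm y = 1"
    using opt by (auto simp: optimal_def feasible_set_def)
  have Ay: "A\<^sup>T *\<^sub>v y = ?d"
    unfolding A_def
    by (rule transpose_A_mat_mult[OF fin YS y(1)]) (use act in \<open>auto simp: active_set_def\<close>)
  have optI: "optimal (N - 1) m Y \<delta> xbar sbar w"
    if "w \<in> feasible_set (N - 1) m Y \<delta>" "y \<bullet> xbar \<le> w \<bullet> xbar" for w
    using opt that unfolding optimal_def objective_def by fastforce
  show ?thesis
  proof (intro conjI impI ballI)
    assume "P *\<^sub>v xbar \<noteq> 0\<^sub>v (N - 1)" and feas: "\<forall>i\<in>{1..m}. ystar \<bullet> Y i \<le> \<delta>"
    then have "proj_kernel *\<^sub>v xbar \<noteq> 0\<^sub>v (N - 1)" by (simp add: P_eq)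
    from slice_maximizer[OF d xbar y(1) Ay y(2) this, folded p_eq P_eq, folded ystar_def]
    show "optimal (N - 1) m Y \<delta> xbar sbar ystar"
      using feas by (intro optI) (auto simp: feasible_set_def)
  next
    fix z
    assume Px: "P *\<^sub>v xbar = 0\<^sub>v (N - 1)" and z: "z \<in> mat_kernel (A\<^sup>T)"
      and feas: "p + z \<in> feasible_set (N - 1) m Y \<delta>"
    obtain z0 where z0: "z0 \<in> carrier_vec (N - 1)" "A\<^sup>T *\<^sub>v z0 = 0\<^sub>v (card S)" "y = p + z0"
      using slice_decomposition[OF d y(1) Ay] unfolding p_eq by blast
    have "y \<bullet> xbar = p \<bullet> xbar"
      using slice_constant[OF xbar Px[unfolded P_eq] p z0(1,2)] z0(3) by simp
    also have "\<dots> = (p + z) \<bullet> xbar"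
      using slice_constant[OF xbar Px[unfolded P_eq] p mat_kernelD[OF At z]] by simp
    finally show "optimal (N - 1) m Y \<delta> xbar sbar (p + z)"
      using feas by (intro optI) auto
  qed
qed

end
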